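(* Let $\beta>0$, let $\nu$ be a positive integer, let $t\in\mathbb{R}$, and let $\{Z(t)\}_{t\in\mathbb{R}}$ be the moving maximum process generated by the $t$-density $$\phi(x)=\frac{\beta\,\Gamma((\nu+1)/2)}{\sqrt{\pi\nu}\,\Gamma(\nu/2)}\left\{1+\frac{\beta^2x^2}{\nu}\right\}^{-(\nu+1)/2}.$$ Let $T_{\nu,1}$ be a random variable having the Student $t$-distribution with $\nu$ degrees of freedom and scale parameter $1$. Put $$b_{1,\nu}=1+\frac{\beta^2t^2}{2\nu}-\frac{\beta|t|}{\sqrt\nu}\sqrt{1+\frac{\beta^2t^2}{4\nu}},\qquad b_{2,\nu}=1+\frac{\beta^2t^2}{2\nu}+\frac{\beta|t|}{\sqrt\nu}\sqrt{1+\frac{\beta^2t^2}{4\nu}},$$ $$p_{1,\nu}(\beta,t,x)=P\left\{\left|T_{\nu,1}-\frac{\beta t}{1-x}\right|\le\beta\sqrt{\frac{t^2x}{(1-x)^2}-\frac{\nu}{\beta^2}}\right\},\qquad p_{2,\nu}(\beta,t,x)=P\left\{\left|T_{\nu,1}-\frac{\beta tx}{1-x}\right|\le\beta\sqrt{\frac{t^2x}{(1-x)^2}-\frac{\nu}{\beta^2}}\right\}.$$ Then for all $w_1,w_2>0$, with $x=(w_1/w_2)^{2/(\nu+1)}$, $$-\log P\{Z(0)\le w_1,Z(t)\le w_2\}=\begin{cases}\dfrac1{w_2}, & 0<w_2<b_{2,\nu}^{-(\nu+1)/2}w_1,\\[2mm] \dfrac1{w_1}p_{1,\nu}(\beta,t,x)+\dfrac1{w_2}\bigl(1-p_{2,\nu}(\beta,t,x)\bigr),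 & b_{2,\nu}^{-(\nu+1)/2}w_1\le w_2<w_1,\\[2mm] \dfrac2w P\left\{T_{\nu,1}\le\dfrac{\beta|t|}{2}\right\}, & w_1=w_2=:w,\\[2mm] \dfrac1{w_1}\bigl(1-p_{1,\nu}(\beta,t,x)\bigr)+\dfrac1{w_2}p_{2,\nu}(\beta,t,x), & w_1<w_2<b_{1,\nu}^{-(\nu+1)/2}w_1,\\[2mm] \dfrac1{w_1}, & w_2\ge b_{1,\nu}^{-(\nu+1)/2}w_1,\end{cases}$$ and this quantity also equals $\dfrac1{w_1}+\dfrac1{w_2}+\dfrac1{w_2}\,\chi\!\left(\dfrac{w_2}{w_1}\right)$, where for $s>0$ $$\chi(s)=\begin{cases}-s, & 0<s\le b_{2,\nu}^{-(\nu+1)/2},\\ s\,p_{1,\nu}(\beta,t,s^{-2/(\nu+1)})-s-p_{2,\nu}(\beta,t,s^{-2/(\nu+1)}), & b_{2,\nu}^{-(\nu+1)/2}<s\le1,\\ -s\,p_{1,\nu}(\beta,t,s^{-2/(\nu+1)})-1+p_{2,\nu}(\beta,t,s^{-2/(\nu+1)}), & 1<s\le b_{1,\nu}^{-(\nu+1)/2},\\ -1, & s>b_{1,\nu}^{-(\nu+1)/2},\end{cases}$$ the value of the second line at $s=1$ (relevant when $t\neq 0$) being understood as the limit as $s\uparrow1$.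
   Context: For a unimodal continuous probability density $\phi$ on $\mathbb{R}$, let $\{(X_j,Y_j)\}_{j\ge1}$ be the points of a homogeneous (unit intensity) Poisson process on $\mathbb{R}\times\mathbb{R}_+$. The moving maximum process generated by $\phi$ is $$Z(t):=\max_{j\ge1}\frac{\phi(X_j-t)}{Y_j},\qquad t\in\mathbb{R}.$$ It is stationary and simple max-stable, with finite-dimensional distributions $$P\{Z(t_1)\le x_1,\dots,Z(t_d)\le x_d\}=\exp\left\{-\int_{-\infty}^{\infty}\max_{1\le i\le d}\frac{\phi(s-t_i)}{x_i}\,ds\right\},\qquad t_i\in\mathbb{R},\ x_i>0.$$ *)

theory Defs
  imports "HOL-Probability.Probability"
begin

text \<open>The number of indices \<open>j\<close> with \<open>P j \<omega> \<in> A\<close>, with value \<open>\<infinity>\<close> if there are infinitely many.\<close>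

definition point_count :: "(nat \<Rightarrow> 'w \<Rightarrow> 'a) \<Rightarrow> 'a set \<Rightarrow> 'w \<Rightarrow> ennreal" where
  "point_count P A \<omega> = emeasure (count_space UNIV) {j. P j \<omega> \<in> A}"

text \<open>
  \<open>P 0, P 1, \<dots>\<close> enumerate the points of a Poisson process on the measure space \<open>\<mu>\<close>, whose
  measure is the intensity measure: the counts in sets of finite measure are Poisson distributed,
  those in sets of infinite measure are almost surely infinite, and the counts in disjoint sets
  are independent.
\<close>

definition poisson_process :: "'w measure \<Rightarrow> 'a measure \<Rightarrow> (nat \<Rightarrow> 'w \<Rightarrow> 'a) \<Rightarrow> bool" where
  "poisson_process M \<mu> P \<longleftrightarrow>
     (\<forall>j. P j \<in> measurable M \<mu>) \<and>
     (\<forall>A\<in>sets \<mu>. emeasure \<mu> A < \<infinity> \<longrightarrow>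
        (\<forall>k. measure M {\<omega>\<in>space M. point_count P A \<omega> = of_nat k}
              = exp (- measure \<mu> A) * measure \<mu> A ^ k / fact k)) \<and>
     (\<forall>A\<in>sets \<mu>. emeasure \<mu> A = \<infinity> \<longrightarrow> (AE \<omega> in M. point_count P A \<omega> = \<infinity>)) \<and>
     (\<forall>(I :: nat set) A. finite I \<longrightarrow> A ` I \<subseteq> sets \<mu> \<longrightarrow> disjoint_family_on A I \<longrightarrow>
        prob_space.indep_vars M (\<lambda>_. borel) (\<lambda>i. point_count P (A i)) I)"

text \<open>
  Lebesgue measure on \<open>\<real> \<times> (0,\<infinity>)\<close>. Almost surely a unit-rate process has no points with
  second coordinate \<open>0\<close>; they are excluded here so that division by \<open>Y\<^sub>j\<close> is meaningful.
\<close>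

definition lebesgue_half_plane :: "(real \<times> real) measure" where
  "lebesgue_half_plane = restrict_space lborel (UNIV \<times> {0<..})"

text \<open>
  The maximum is written as a supremum in the extended reals, which is meaningful for every
  outcome; almost surely it is finite and attained.
\<close>

definition moving_maximum ::
    "(real \<Rightarrow> real) \<Rightarrow> (nat \<Rightarrow> 'w \<Rightarrow> real) \<Rightarrow> (nat \<Rightarrow> 'w \<Rightarrow> real) \<Rightarrow> real \<Rightarrow> 'w \<Rightarrow> ereal" where
  "moving_maximum \<phi> X Y t \<omega> = (SUP j. ereal (\<phi> (X j \<omega> - t) / Y j \<omega>))"

text \<open>
  The density of \<open>T / \<beta>\<close> for \<open>T\<close> Student-distributed with \<open>\<nu>\<close> degrees of freedom and scale
  parameter \<open>1\<close>; the standard Student density is the case \<open>\<beta> = 1\<close>.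
\<close>

definition t_density :: "real \<Rightarrow> nat \<Rightarrow> real \<Rightarrow> real" where
  "t_density \<beta> \<nu> x =
     \<beta> * Gamma ((real \<nu> + 1) / 2) / (sqrt (pi * real \<nu>) * Gamma (real \<nu> / 2))
       * (1 + \<beta>\<^sup>2 * x\<^sup>2 / real \<nu>) powr (- ((real \<nu> + 1) / 2))"

definition b1 :: "nat \<Rightarrow> real \<Rightarrow> real \<Rightarrow> real" where
  "b1 \<nu> \<beta> t = 1 + \<beta>\<^sup>2 * t\<^sup>2 / (2 * real \<nu>)
     - \<beta> * \<bar>t\<bar> / sqrt (real \<nu>) * sqrt (1 + \<beta>\<^sup>2 * t\<^sup>2 / (4 * real \<nu>))"

definition b2 :: "nat \<Rightarrow> real \<Rightarrow> real \<Rightarrow> real" where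
  "b2 \<nu> \<beta> t = 1 + \<beta>\<^sup>2 * t\<^sup>2 / (2 * real \<nu>)
     + \<beta> * \<bar>t\<bar> / sqrt (real \<nu>) * sqrt (1 + \<beta>\<^sup>2 * t\<^sup>2 / (4 * real \<nu>))"

text \<open>
  Below, \<open>T\<close> is a random variable on \<open>N\<close>, to be taken Student-distributed with \<open>\<nu>\<close> degrees of
  freedom.
\<close>

definition p1 :: "'v measure \<Rightarrow> ('v \<Rightarrow> real) \<Rightarrow> nat \<Rightarrow> real \<Rightarrow> real \<Rightarrow> real \<Rightarrow> real" where
  "p1 N T \<nu> \<beta> t x = measure N {\<omega>\<in>space N.
     \<bar>T \<omega> - \<beta> * t / (1 - x)\<bar> \<le> \<beta> * sqrt (t\<^sup>2 * x / (1 - x)\<^sup>2 - real \<nu> / \<beta>\<^sup>2)}"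

definition p2 :: "'v measure \<Rightarrow> ('v \<Rightarrow> real) \<Rightarrow> nat \<Rightarrow> real \<Rightarrow> real \<Rightarrow> real \<Rightarrow> real" where
  "p2 N T \<nu> \<beta> t x = measure N {\<omega>\<in>space N.
     \<bar>T \<omega> - \<beta> * t * x / (1 - x)\<bar> \<le> \<beta> * sqrt (t\<^sup>2 * x / (1 - x)\<^sup>2 - real \<nu> / \<beta>\<^sup>2)}"

definition chi_below :: "'v measure \<Rightarrow> ('v \<Rightarrow> real) \<Rightarrow> nat \<Rightarrow> real \<Rightarrow> real \<Rightarrow> real \<Rightarrow> real" where
  "chi_below N T \<nu> \<beta> t s =
     s * p1 N T \<nu> \<beta> t (s powr (- 2 / (real \<nu> + 1))) - s
       - p2 N T \<nu> \<beta> t (s powr (- 2 / (real \<nu> + 1)))"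

definition chi_above :: "'v measure \<Rightarrow> ('v \<Rightarrow> real) \<Rightarrow> nat \<Rightarrow> real \<Rightarrow> real \<Rightarrow> real \<Rightarrow> real" where
  "chi_above N T \<nu> \<beta> t s =
     - s * p1 N T \<nu> \<beta> t (s powr (- 2 / (real \<nu> + 1))) - 1
       + p2 N T \<nu> \<beta> t (s powr (- 2 / (real \<nu> + 1)))"

text \<open>
  At \<open>s = 1\<close> the expressions \<open>p1\<close> and \<open>p2\<close> would divide by zero, so there the value is the
  limit from the left. For \<open>t = 0\<close> the first branch applies at \<open>s = 1\<close>.
\<close>

definition chi :: "'v measure \<Rightarrow> ('v \<Rightarrow> real) \<Rightarrow> nat \<Rightarrow> real \<Rightarrow> real \<Rightarrow> real \<Rightarrow> real" where
  "chi N T \<nu> \<beta> t s =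
     (if s \<le> b2 \<nu> \<beta> t powr (- ((real \<nu> + 1) / 2)) then - s
      else if s < 1 then chi_below N T \<nu> \<beta> t s
      else if s = 1 then Lim (at_left 1) (chi_below N T \<nu> \<beta> t)
      else if s \<le> b1 \<nu> \<beta> t powr (- ((real \<nu> + 1) / 2)) then chi_above N T \<nu> \<beta> t s
      else - 1)"

end

theory Submission
  imports Defs
begin

text \<open>
  The event \<open>Z 0 \<le> w1 \<and> Z t \<le> w2\<close> says that the Poisson process has no point below the graph of
  \<open>s \<mapsto> max (\<phi> s / w1) (\<phi> (s - t) / w2)\<close>, so \<open>V\<close> is the integral of this maximum. Comparing the two
  Student densities amounts to a quadratic inequality in \<open>s\<close>, whose solution set is an interval
  around \<open>t / (1 - x)\<close> or its complement (a half line if \<open>x = 1\<close>); splitting the integral there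
  produces \<open>p1\<close> and \<open>p2\<close>. The numbers \<open>b1\<close> and \<open>b2\<close> are the values of \<open>x\<close> at which the discriminant
  vanishes, so outside \<open>(b1, b2)\<close> both probabilities are \<open>0\<close>. The left limit of \<open>chi\<close> at \<open>1\<close> is
  obtained from the Lipschitz continuity of the integral in \<open>1 / w1\<close>.
\<close>

lemma t_density_nonneg:
  assumes "\<beta> > 0" "\<nu> > 0"
  shows "t_density \<beta> \<nu> x \<ge> 0"
  using assms unfolding t_density_def by (simp add: Gamma_real_nonneg)

lemma t_density_measurable [measurable]: "t_density \<beta> \<nu> \<in> borel_measurable borel"
  unfolding t_density_def by measurable

lemma t_density_minus [simp]: "t_density \<beta> \<nu> (- x) = t_density \<beta> \<nu> x"
  unfolding t_density_def by simp

lemma t_density_scale: "t_density \<beta> \<nu> x = \<beta> * t_density 1 \<nu> (\<beta> * x)"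
  unfolding t_density_def by (simp add: power_mult_distrib)

section \<open>Void probabilities and the bivariate distribution of the moving maximum\<close>

text \<open>Measurability into a restricted space confines all values to it, so positivity holds for
  every outcome and quotients by \<open>Y j \<omega>\<close> can be rearranged pointwise.\<close>

lemma half_plane_process_pos:
  assumes "poisson_process M lebesgue_half_plane (\<lambda>j \<omega>. (X j \<omega>, Y j \<omega>))"
    and "\<omega> \<in> space M"
  shows "Y j \<omega> > 0"
proof -
  have "(\<lambda>\<omega>. (X j \<omega>, Y j \<omega>)) \<in> measurable M lebesgue_half_plane"
    using assms(1) unfolding poisson_process_def by blast
  from measurable_space[OF this assms(2)] show ?thesis
    by (simp add: lebesgue_half_plane_def space_restrict_space)
qed

text \<open>The event says that the region under the graph of \<open>\<psi>\<close> contains no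
  point. Tonelli gives its area as the integral of \<open>\<psi>\<close>, and the Poisson weight at
  \<open>k = 0\<close> is the exponential.\<close>

lemma void_probability:
  fixes M :: "'w measure" and \<psi> :: "real \<Rightarrow> real"
  assumes pp: "poisson_process M lebesgue_half_plane (\<lambda>j \<omega>. (X j \<omega>, Y j \<omega>))"
    and [measurable]: "\<psi> \<in> borel_measurable borel"
    and int: "integrable lborel \<psi>" and nonneg: "\<And>x. \<psi> x \<ge> 0"
  shows "measure M {\<omega>\<in>space M. \<forall>j. \<psi> (X j \<omega>) \<le> Y j \<omega>} = exp (- (\<integral>x. \<psi> x \<partial>lborel))"
proof -
  \<comment> \<open>The strict upper bound makes \<open>A\<close> exactly the part of the half plane
    where \<open>\<psi> (X j \<omega>) \<le> Y j \<omega>\<close> fails, so the two events below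
    agree without null sets.\<close>
  define A where "A = {p :: real \<times> real. 0 < snd p \<and> snd p < \<psi> (fst p)}"
  have "{p \<in> space (borel \<Otimes>\<^sub>M borel). 0 < snd p \<and> snd p < \<psi> (fst p)}
      \<in> sets (borel \<Otimes>\<^sub>M borel)"
    by measurable
  then have A_borel: "A \<in> sets borel"
    unfolding A_def borel_prod by simp
  have upper: "UNIV \<times> {0<..} \<in> sets (borel :: (real \<times> real) measure)"
    by (simp add: borel_open open_Times)
  have sub: "A \<subseteq> UNIV \<times> {0<..}"
    by (auto simp: A_def)
  have A_sets: "A \<in> sets lebesgue_half_plane"
    using A_borel upper sub unfolding lebesgue_half_plane_def
    by (simp add: sets_restrict_space_iff)
  have "emeasure lebesgue_half_plane A = emeasure lborel A"
    using upper sub unfolding lebesgue_half_plane_def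
    by (simp add: emeasure_restrict_space)
  also have "\<dots> = emeasure (lborel \<Otimes>\<^sub>M lborel) A"
    by (simp add: lborel_prod)
  also have "\<dots> = (\<integral>\<^sup>+x. emeasure lborel (Pair x -` A) \<partial>lborel)"
    using A_borel by (intro lborel.emeasure_pair_measure_alt)
       (simp only: lborel_prod sets_lborel)
  also have "\<dots> = (\<integral>\<^sup>+x. ennreal (\<psi> x) \<partial>lborel)"
  proof (rule nn_integral_cong)
    fix x :: real
    have "Pair x -` A = {0<..<\<psi> x}"
      by (auto simp: A_def)
    then show "emeasure lborel (Pair x -` A) = ennreal (\<psi> x)"
      using nonneg[of x] by simp
  qed
  also have "\<dots> = ennreal (\<integral>x. \<psi> x \<partial>lborel)"
    using int nonneg by (intro nn_integral_eq_integral) auto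
  finally have em: "emeasure lebesgue_half_plane A = ennreal (\<integral>x. \<psi> x \<partial>lborel)" .
  then have m: "measure lebesgue_half_plane A = (\<integral>x. \<psi> x \<partial>lborel)"
    using nonneg by (simp add: measure_def)
  note pos = half_plane_process_pos[OF pp]
  have "{\<omega>\<in>space M. \<forall>j. \<psi> (X j \<omega>) \<le> Y j \<omega>}
      = {\<omega>\<in>space M. point_count (\<lambda>j \<omega>. (X j \<omega>, Y j \<omega>)) A \<omega> = of_nat 0}"
    using pos by (auto simp: point_count_def emeasure_count_space_eq_0 A_def not_less) (meson not_le)
  also have "measure M \<dots> = exp (- measure lebesgue_half_plane A)"
  proof -
    have "emeasure lebesgue_half_plane A < \<infinity>"
      by (simp add: em)
    then have "measure M {\<omega>\<in>space M. point_count (\<lambda>j \<omega>. (X j \<omega>, Y j \<omega>)) A \<omega> = of_nat k}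
        = exp (- measure lebesgue_half_plane A) * measure lebesgue_half_plane A ^ k / fact k" for k
      using pp A_sets unfolding poisson_process_def by blast
    from this[of 0] show ?thesis
      by simp
  qed
  finally show ?thesis
    by (simp add: m)
qed

text \<open>A supremum is bounded by \<open>w\<close> iff each term is, and since
  \<open>Y j \<omega> > 0\<close> the bound on a term reads
  \<open>\<phi> (X j \<omega> - c) / w \<le> Y j \<omega>\<close>. The two conditions merge into one
  void event for the maximum.\<close>

lemma moving_maximum_fdd2:
  fixes M :: "'w measure" and \<phi> :: "real \<Rightarrow> real"
  assumes pp: "poisson_process M lebesgue_half_plane (\<lambda>j \<omega>. (X j \<omega>, Y j \<omega>))"
    and [measurable]: "\<phi> \<in> borel_measurable borel"
    and int: "integrable lborel \<phi>" and nonneg: "\<And>x. \<phi> x \<ge> 0"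
    and "w1 > 0" "w2 > 0"
  shows "measure M {\<omega>\<in>space M. moving_maximum \<phi> X Y t1 \<omega> \<le> ereal w1 \<and>
                               moving_maximum \<phi> X Y t2 \<omega> \<le> ereal w2}
         = exp (- (\<integral>s. max (\<phi> (s - t1) / w1) (\<phi> (s - t2) / w2) \<partial>lborel))"
proof -
  have shift: "integrable lborel (\<lambda>s. \<phi> (s - c))" for c
    using lborel_integrable_real_affine[OF int, of 1 "-c"] by simp
  note pos = half_plane_process_pos[OF pp]
  have "moving_maximum \<phi> X Y c \<omega> \<le> ereal w \<longleftrightarrow> (\<forall>j. \<phi> (X j \<omega> - c) / w \<le> Y j \<omega>)"
    if "\<omega> \<in> space M" "w > 0" for c w \<omega>
    using pos[OF that(1)] that(2)
    by (simp add: moving_maximum_def SUP_le_iff pos_divide_le_eq mult.commute)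
  then have "{\<omega>\<in>space M. moving_maximum \<phi> X Y t1 \<omega> \<le> ereal w1 \<and>
                     moving_maximum \<phi> X Y t2 \<omega> \<le> ereal w2}
     = {\<omega>\<in>space M. \<forall>j. max (\<phi> (X j \<omega> - t1) / w1) (\<phi> (X j \<omega> - t2) / w2) \<le> Y j \<omega>}"
    using assms(5,6) by auto
  also have "measure M \<dots> = exp (- (\<integral>s. max (\<phi> (s - t1) / w1) (\<phi> (s - t2) / w2) \<partial>lborel))"
    using shift nonneg assms(5,6) by (intro void_probability[OF pp]) (auto simp: le_max_iff_disj)
  finally show ?thesis .
qed

section \<open>The law of the rescaled and shifted Student variable\<close>

text \<open>The variable \<open>T / \<beta> + c\<close> has the shifted density; the shifts
  \<open>0\<close> and \<open>t\<close> correspond to the two functions under the maximum.\<close>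

lemma distributed_t_density:
  fixes T :: "'v \<Rightarrow> real"
  assumes dist: "distributed N lborel T (\<lambda>y. ennreal (t_density 1 \<nu> y))"
    and "\<beta> > 0" "\<nu> > 0"
    and [measurable]: "B \<in> sets borel"
  shows "measure N {\<omega>\<in>space N. T \<omega> / \<beta> + c \<in> B}
         = (\<integral>s. t_density \<beta> \<nu> (s - c) * indicator B s \<partial>lborel)"
proof -
  have [measurable]: "T \<in> borel_measurable N"
    using distributed_measurable[OF dist] by simp
  have "measure N {\<omega>\<in>space N. T \<omega> / \<beta> + c \<in> B} = (\<integral>\<omega>. indicator B (T \<omega> / \<beta> + c) \<partial>N)"
  proof -
    have "(\<integral>\<omega>. indicator B (T \<omega> / \<beta> + c) \<partial>N)
        = (\<integral>\<omega>. indicator {\<omega>\<in>space N. T \<omega> / \<beta> + c \<in> B} \<omega> \<partial>N)"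
      by (intro Bochner_Integration.integral_cong) (auto simp: indicator_def)
    also have "\<dots> = measure N ({\<omega>\<in>space N. T \<omega> / \<beta> + c \<in> B} \<inter> space N)"
      by (rule Bochner_Integration.integral_indicator)
    finally show ?thesis
      by (simp add: Int_absorb2)
  qed
  also have "\<dots> = (\<integral>y. t_density 1 \<nu> y * indicator B (y / \<beta> + c) \<partial>lborel)"
    using distributed_integral[OF dist, of "\<lambda>y. indicator B (y / \<beta> + c) :: real"] assms
    by (simp add: t_density_nonneg)
  also have "\<dots> = \<beta> * (\<integral>s. t_density 1 \<nu> (\<beta> * (s - c)) * indicator B s \<partial>lborel)"
    using \<open>\<beta> > 0\<close>
    \<comment> \<open>This is the substitution \<open>y = \<beta> * (s - c)\<close>, whose Jacobian
      is \<open>\<beta>\<close>.\<close>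
    by (subst lborel_integral_real_affine[where c = \<beta> and t = "- \<beta> * c"])
       (auto simp: field_simps)
  also have "\<dots> = (\<integral>s. t_density \<beta> \<nu> (s - c) * indicator B s \<partial>lborel)"
    by (subst t_density_scale) (simp add: mult.assoc)
  finally show ?thesis .
qed

text \<open>The Bochner integral of a non-integrable function is \<open>0\<close> by convention,
  whereas this one equals the total mass \<open>1\<close> of \<open>N\<close>. No Gamma integral has
  to be evaluated.\<close>

lemma integrable_t_density:
  fixes T :: "'v \<Rightarrow> real"
  assumes "prob_space N" and dist: "distributed N lborel T (\<lambda>y. ennreal (t_density 1 \<nu> y))"
    and "\<beta> > 0" "\<nu> > 0"
  shows "integrable lborel (t_density \<beta> \<nu>)"
proof (rule ccontr)
  assume "\<not> integrable lborel (t_density \<beta> \<nu>)"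
  then have "(\<integral>s. t_density \<beta> \<nu> s \<partial>lborel) = 0"
    by (rule not_integrable_integral_eq)
  moreover have "(\<integral>s. t_density \<beta> \<nu> s \<partial>lborel) = 1"
    using distributed_t_density[OF dist assms(3,4), of UNIV 0] prob_space.prob_space[OF assms(1)]
    by simp
  ultimately show False by simp
qed

section \<open>Comparing the two densities through a quadratic polynomial\<close>

text \<open>The number \<open>x\<close> is chosen so that its power \<open>(\<nu> + 1) / 2\<close>
  is \<open>w1 / w2\<close>; the common exponent can then be removed by monotonicity.\<close>

lemma t_density_ratio_le_iff:
  assumes "\<beta> > 0" "\<nu> > 0" "w1 > 0" "w2 > 0"
  defines "x \<equiv> (w1 / w2) powr (2 / (real \<nu> + 1))"
  shows "t_density \<beta> \<nu> u / w2 \<le> t_density \<beta> \<nu> v / w1 \<longleftrightarrow>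
         x * (1 + \<beta>\<^sup>2 * v\<^sup>2 / real \<nu>) \<le> 1 + \<beta>\<^sup>2 * u\<^sup>2 / real \<nu>"
proof -
  define k where "k = (real \<nu> + 1) / 2"
  define C where "C = \<beta> * Gamma ((real \<nu> + 1) / 2) / (sqrt (pi * real \<nu>) * Gamma (real \<nu> / 2))"
  define a where "a = 1 + \<beta>\<^sup>2 * v\<^sup>2 / real \<nu>"
  define b where "b = 1 + \<beta>\<^sup>2 * u\<^sup>2 / real \<nu>"
  have k: "k > 0" and ab: "a > 0" "b > 0" and x: "x > 0"
    using assms by (auto simp: k_def a_def b_def x_def intro!: add_pos_nonneg)
  have C: "C > 0"
    using assms unfolding C_def by (intro divide_pos_pos mult_pos_pos Gamma_real_pos) auto
  have xk: "x powr k = w1 / w2"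
  proof -
    have "2 / (real \<nu> + 1) * k = 1"
      by (simp add: k_def)
    then show ?thesis
      using assms(3,4) by (simp add: x_def powr_powr)
  qed
  have "t_density \<beta> \<nu> u / w2 \<le> t_density \<beta> \<nu> v / w1 \<longleftrightarrow>
        C * b powr (- k) / w2 \<le> C * a powr (- k) / w1"
    unfolding t_density_def C_def k_def a_def b_def ..
  also have "\<dots> \<longleftrightarrow> (w1 / w2) * a powr k \<le> b powr k"
    using C ab assms by (simp add: powr_minus field_simps)
  also have "\<dots> \<longleftrightarrow> (x * a) powr k \<le> b powr k"
    using x ab by (simp add: powr_mult xk)
  also have "\<dots> \<longleftrightarrow> x * a \<le> b"
    using k x ab by (meson less_eq_real_def linorder_not_less mult_pos_pos powr_less_mono2 powr_mono2)
  finally show ?thesis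
    unfolding a_def b_def .
qed

text \<open>Exchanging the roles of the two weights replaces \<open>x\<close> by
  \<open>1 / x\<close>.\<close>

lemma t_density_ratio_ge_iff:
  assumes "\<beta> > 0" "\<nu> > 0" "w1 > 0" "w2 > 0"
  defines "x \<equiv> (w1 / w2) powr (2 / (real \<nu> + 1))"
  shows "t_density \<beta> \<nu> v / w1 \<le> t_density \<beta> \<nu> u / w2 \<longleftrightarrow>
         1 + \<beta>\<^sup>2 * u\<^sup>2 / real \<nu> \<le> x * (1 + \<beta>\<^sup>2 * v\<^sup>2 / real \<nu>)"
proof -
  have "(w2 / w1) powr (2 / (real \<nu> + 1)) = 1 / x" and "x > 0"
    using assms by (auto simp: x_def powr_divide)
  have "t_density \<beta> \<nu> v / w1 \<le> t_density \<beta> \<nu> u / w2 \<longleftrightarrow>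
        1 / x * (1 + \<beta>\<^sup>2 * u\<^sup>2 / real \<nu>) \<le> 1 + \<beta>\<^sup>2 * v\<^sup>2 / real \<nu>"
    using t_density_ratio_le_iff[OF assms(1,2) assms(4,3), of v u]
    by (simp only: \<open>(w2 / w1) powr (2 / (real \<nu> + 1)) = 1 / x\<close>)
  then show ?thesis
    using \<open>x > 0\<close> by (simp add: pos_divide_le_eq mult.commute)
qed

text \<open>The real number \<open>D\<close> is also allowed to be negative: the square root is odd.\<close>

lemma abs_le_sqrt_iff: "\<bar>u\<bar> \<le> sqrt D \<longleftrightarrow> u\<^sup>2 \<le> D"
  by (metis real_sqrt_abs real_sqrt_le_iff)

text \<open>Dividing by \<beta> and squaring gives a set of \<open>s\<close> that also serves for
  \<open>p2\<close>. The shift \<open>+ 0\<close> matches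
  \<open>distributed_t_density\<close>.\<close>

lemma p1_altdef:
  assumes "\<beta> > 0"
  shows "p1 N T \<nu> \<beta> t x = measure N {\<omega>\<in>space N.
           T \<omega> / \<beta> + 0 \<in> {s. (s - t / (1 - x))\<^sup>2 \<le> t\<^sup>2 * x / (1 - x)\<^sup>2 - real \<nu> / \<beta>\<^sup>2}}"
proof -
  have "T \<omega> - \<beta> * t / (1 - x) = \<beta> * (T \<omega> / \<beta> - t / (1 - x))" for \<omega>
    using assms by (simp add: algebra_simps)
  then show ?thesis
    using assms unfolding p1_def by (simp add: abs_mult flip: abs_le_sqrt_iff)
qed

text \<open>Since \<open>t * x / (1 - x) = t / (1 - x) - t\<close>, shifting by \<open>t\<close>
  moves the centre of this interval to that of \<open>p1\<close>.\<close>

lemma p2_altdef: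
  assumes "\<beta> > 0" "x \<noteq> 1"
  shows "p2 N T \<nu> \<beta> t x = measure N {\<omega>\<in>space N.
           T \<omega> / \<beta> + t \<in> {s. (s - t / (1 - x))\<^sup>2 \<le> t\<^sup>2 * x / (1 - x)\<^sup>2 - real \<nu> / \<beta>\<^sup>2}}"
proof -
  have "T \<omega> - \<beta> * t * x / (1 - x) = \<beta> * (T \<omega> / \<beta> + t - t / (1 - x))" for \<omega>
  proof -
    have "t * x / (1 - x) = t / (1 - x) - t"
      using assms by (simp add: field_simps)
    then have "\<beta> * t * x / (1 - x) = \<beta> * (t / (1 - x) - t)"
      by (metis mult.assoc times_divide_eq_right)
    then show ?thesis
      using assms by (simp add: algebra_simps)
  qed
  then show ?thesis
    using assms unfolding p2_def by (simp add: abs_mult flip: abs_le_sqrt_iff)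
qed

text \<open>Completing the square in \<open>s\<close>. Whether the first density dominates inside or
  outside the resulting interval depends on the sign of \<open>1 - x\<close>.\<close>

lemma quadratic_factor:
  fixes \<beta> t x s n :: real
  assumes "\<beta> > 0" "n > 0" "x \<noteq> 1"
  shows "(1 + \<beta>\<^sup>2 * (s - t)\<^sup>2 / n) - x * (1 + \<beta>\<^sup>2 * s\<^sup>2 / n)
       = \<beta>\<^sup>2 / n * (1 - x) * ((s - t / (1 - x))\<^sup>2 - (t\<^sup>2 * x / (1 - x)\<^sup>2 - n / \<beta>\<^sup>2))"
proof -
  define y where "y = 1 - x"
  have y: "y \<noteq> 0" and x: "x = 1 - y"
    using assms by (auto simp: y_def)
  show ?thesis
    unfolding x using assms y by (simp add: field_simps power2_eq_square)
qed

section \<open>The thresholds as roots of a quadratic equation\<close>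

text \<open>With \<open>b1_mult_b2\<close> this identifies \<open>b1\<close> and \<open>b2\<close>
  as the roots in \<open>x\<close> of
  \<open>(1 - x)\<^sup>2 = \<beta>\<^sup>2 * t\<^sup>2 / \<nu> * x\<close>, by Vieta.\<close>

lemma b1_plus_b2: "b1 \<nu> \<beta> t + b2 \<nu> \<beta> t = 2 + \<beta>\<^sup>2 * t\<^sup>2 / real \<nu>"
  unfolding b1_def b2_def by simp

lemma b1_mult_b2:
  assumes "\<nu> > 0"
  shows "b1 \<nu> \<beta> t * b2 \<nu> \<beta> t = 1"
proof -
  define q where "q = \<beta>\<^sup>2 * t\<^sup>2 / real \<nu>"
  \<comment> \<open>Here \<open>r\<^sup>2 = q + q\<^sup>2 / 4\<close>, so that
    \<open>(1 + q / 2)\<^sup>2 - r\<^sup>2 = 1\<close>.\<close>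
  define r where "r = \<beta> * \<bar>t\<bar> / sqrt (real \<nu>) * sqrt (1 + q / 4)"
  have "q \<ge> 0"
    by (simp add: q_def)
  then have r: "r\<^sup>2 = q * (1 + q / 4)"
    by (simp add: r_def power_mult_distrib power_divide q_def)
  have "b1 \<nu> \<beta> t = 1 + q / 2 - r" "b2 \<nu> \<beta> t = 1 + q / 2 + r"
    unfolding b1_def b2_def r_def q_def by (simp_all add: mult.commute)
  then have "b1 \<nu> \<beta> t * b2 \<nu> \<beta> t = (1 + q / 2 - r) * (1 + q / 2 + r)"
    by simp
  also have "\<dots> = (1 + q / 2)\<^sup>2 - r\<^sup>2"
    by (simp add: power2_eq_square algebra_simps)
  finally show ?thesis
    unfolding r by (simp add: power2_eq_square algebra_simps)
qed

lemma b1_le_b2: "\<beta> > 0 \<Longrightarrow> b1 \<nu> \<beta> t \<le> b2 \<nu> \<beta> t"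
proof -
  assume "\<beta> > 0"
  then have "0 \<le> \<beta> * \<bar>t\<bar> / sqrt (real \<nu>) * sqrt (1 + \<beta>\<^sup>2 * t\<^sup>2 / (4 * real \<nu>))"
    by simp
  moreover have "a - r \<le> a + r" if "0 \<le> r" for a r :: real
    using that by simp
  ultimately show ?thesis
    unfolding b1_def b2_def by blast
qed

lemma b2_ge_1: "\<beta> > 0 \<Longrightarrow> b2 \<nu> \<beta> t \<ge> 1"
  unfolding b2_def by simp

lemma b2_gt_1: "\<beta> > 0 \<Longrightarrow> \<nu> > 0 \<Longrightarrow> t \<noteq> 0 \<Longrightarrow> b2 \<nu> \<beta> t > 1"
  unfolding b2_def by (simp add: add_pos_nonneg)

lemma b1_pos: "\<beta> > 0 \<Longrightarrow> \<nu> > 0 \<Longrightarrow> b1 \<nu> \<beta> t > 0"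
  using b1_mult_b2[of \<nu> \<beta> t] b2_ge_1[of \<beta> \<nu> t] by (smt (verit) zero_less_mult_iff)

lemma b1_le_1: "\<beta> > 0 \<Longrightarrow> \<nu> > 0 \<Longrightarrow> b1 \<nu> \<beta> t \<le> 1"
  using b1_mult_b2[of \<nu> \<beta> t] b2_ge_1[of \<beta> \<nu> t] b1_pos[of \<beta> \<nu> t]
  by (smt (verit) mult_le_cancel_left1)

lemma b1_less_1: "\<beta> > 0 \<Longrightarrow> \<nu> > 0 \<Longrightarrow> t \<noteq> 0 \<Longrightarrow> b1 \<nu> \<beta> t < 1"
  using b1_mult_b2[of \<nu> \<beta> t] b2_gt_1[of \<beta> \<nu> t] b1_le_1[of \<beta> \<nu> t]
  by (metis less_eq_real_def less_irrefl mult_1)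

section \<open>The exponent function and its form at unequal levels\<close>

locale student_variable = prob_space N for N :: "'v measure" +
  fixes T :: "'v \<Rightarrow> real" and \<beta> :: real and \<nu> :: nat
  assumes beta_pos: "\<beta> > 0" and nu_pos: "\<nu> > 0"
    and dist: "distributed N lborel T (\<lambda>y. ennreal (t_density 1 \<nu> y))"
begin

text \<open>By \<open>moving_maximum_fdd2\<close> this is minus the logarithm of the joint
  distribution function at times \<open>0\<close> and \<open>t\<close>, the exponent function of a
  bivariate max-stable law.\<close>

definition exponent :: "real \<Rightarrow> real \<Rightarrow> real \<Rightarrow> real" where
  "exponent t w1 w2 = (\<integral>s. max (t_density \<beta> \<nu> s / w1) (t_density \<beta> \<nu> (s - t) / w2) \<partial>lborel)"

lemma T_measurable [measurable]: "T \<in> borel_measurable N"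
  using distributed_measurable[OF dist] by simp

lemma integrable_shift: "integrable lborel (\<lambda>s. t_density \<beta> \<nu> (s - c))"
  using lborel_integrable_real_affine[OF integrable_t_density[OF _ dist beta_pos nu_pos], of 1 "-c"]
  by (simp add: prob_space_axioms)

lemmas integrable_phi = integrable_shift[of 0, simplified]

lemma integrable_shift_indicator:
  "B \<in> sets borel \<Longrightarrow> integrable lborel (\<lambda>s. t_density \<beta> \<nu> (s - c) * indicator B s)"
  using integrable_shift by (intro integrable_real_mult_indicator) auto

lemma integral_phi: "(\<integral>s. t_density \<beta> \<nu> s \<partial>lborel) = 1"
  using distributed_t_density[OF dist beta_pos nu_pos, of UNIV 0] prob_space by simp

text \<open>The maximum is its first argument on \<open>B\<close> and its second off
  \<open>B\<close>, so the integral splits into two probabilities. Both inequalities are weak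
  because ties may fall on either side.\<close>

lemma exponent_split:
  assumes [measurable]: "B \<in> sets borel"
    and "\<And>s. s \<in> B \<Longrightarrow> t_density \<beta> \<nu> (s - t) / w2 \<le> t_density \<beta> \<nu> s / w1"
    and "\<And>s. s \<notin> B \<Longrightarrow> t_density \<beta> \<nu> s / w1 \<le> t_density \<beta> \<nu> (s - t) / w2"
  shows "exponent t w1 w2
         = 1 / w1 * prob {\<omega>\<in>space N. T \<omega> / \<beta> + 0 \<in> B}
           + 1 / w2 * (1 - prob {\<omega>\<in>space N. T \<omega> / \<beta> + t \<in> B})"
proof -
  have "exponent t w1 w2
      = (\<integral>s. t_density \<beta> \<nu> (s - 0) * indicator B s / w1
             + t_density \<beta> \<nu> (s - t) * indicator (- B) s / w2 \<partial>lborel)"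
    unfolding exponent_def using assms(2,3)
    by (intro Bochner_Integration.integral_cong) (auto simp: indicator_def max_def intro: antisym)
  also have "\<dots> = (\<integral>s. t_density \<beta> \<nu> (s - 0) * indicator B s \<partial>lborel) / w1
             + (\<integral>s. t_density \<beta> \<nu> (s - t) * indicator (- B) s \<partial>lborel) / w2"
    by (subst Bochner_Integration.integral_add)
       (intro integrable_divide integrable_shift_indicator borel_comp assms(1)
         | simp only: integral_divide_zero)+
  also have "\<dots> = 1 / w1 * prob {\<omega>\<in>space N. T \<omega> / \<beta> + 0 \<in> B}
             + 1 / w2 * prob {\<omega>\<in>space N. T \<omega> / \<beta> + t \<in> - B}"
    by (simp only: distributed_t_density[OF dist beta_pos nu_pos] assms(1) borel_comp)
       simp
  also have "prob {\<omega>\<in>space N. T \<omega> / \<beta> + t \<in> - B}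
             = 1 - prob {\<omega>\<in>space N. T \<omega> / \<beta> + t \<in> B}"
    using prob_neg[of "\<lambda>\<omega>. T \<omega> / \<beta> + t \<in> B"] by simp
  finally show ?thesis .
qed

context
  fixes t w1 w2 x :: real
  assumes w: "w1 > 0" "w2 > 0"
    and x: "x = (w1 / w2) powr (2 / (real \<nu> + 1))"
begin

text \<open>The last factor in \<open>quadratic_factor\<close>; it is nonpositive exactly on the
  interval of \<open>p1_altdef\<close> and \<open>p2_altdef\<close>.\<close>

definition gap :: "real \<Rightarrow> real" where
  "gap s = (s - t / (1 - x))\<^sup>2 - (t\<^sup>2 * x / (1 - x)\<^sup>2 - real \<nu> / \<beta>\<^sup>2)"

lemma
  assumes "x \<noteq> 1"
  shows ratio_le_iff: "t_density \<beta> \<nu> (s - t) / w2 \<le> t_density \<beta> \<nu> s / w1 \<longleftrightarrow> 0 \<le> (1 - x) * gap s"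
    and ratio_ge_iff: "t_density \<beta> \<nu> s / w1 \<le> t_density \<beta> \<nu> (s - t) / w2 \<longleftrightarrow> (1 - x) * gap s \<le> 0"
proof -
  have eq: "(1 + \<beta>\<^sup>2 * (s - t)\<^sup>2 / real \<nu>) - x * (1 + \<beta>\<^sup>2 * s\<^sup>2 / real \<nu>)
          = \<beta>\<^sup>2 / real \<nu> * ((1 - x) * gap s)"
    using quadratic_factor[of \<beta> "real \<nu>" x s t] beta_pos nu_pos assms
    unfolding gap_def by (simp add: mult.assoc)
  have pos: "\<beta>\<^sup>2 / real \<nu> > 0"
    using beta_pos nu_pos by simp
  show "t_density \<beta> \<nu> (s - t) / w2 \<le> t_density \<beta> \<nu> s / w1 \<longleftrightarrow> 0 \<le> (1 - x) * gap s"
    using t_density_ratio_le_iff[OF beta_pos nu_pos w, of "s - t" s] eq pos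
    by (metis diff_ge_0_iff_ge x zero_le_mult_iff not_le less_imp_le)
  show "t_density \<beta> \<nu> s / w1 \<le> t_density \<beta> \<nu> (s - t) / w2 \<longleftrightarrow> (1 - x) * gap s \<le> 0"
    using t_density_ratio_ge_iff[OF beta_pos nu_pos w, of s "s - t"] eq pos
    by (metis diff_le_0_iff_le x mult_le_0_iff not_le less_imp_le)
qed

lemma gap_measurable [measurable]: "gap \<in> borel_measurable borel"
  unfolding gap_def by measurable

lemma
  assumes "x \<noteq> 1"
  shows p1_eq: "p1 N T \<nu> \<beta> t x = prob {\<omega>\<in>space N. T \<omega> / \<beta> + 0 \<in> {s. gap s \<le> 0}}"
    and p2_eq: "p2 N T \<nu> \<beta> t x = prob {\<omega>\<in>space N. T \<omega> / \<beta> + t \<in> {s. gap s \<le> 0}}"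
  using assms by (simp_all add: p1_altdef p2_altdef beta_pos gap_def)

text \<open>Here \<open>x > 1\<close>, so \<open>1 - x\<close> is negative and the first density
  dominates on the interval where \<open>gap\<close> is nonpositive.\<close>

lemma exponent_below:
  assumes "w2 < w1"
  shows "exponent t w1 w2 = 1 / w1 * p1 N T \<nu> \<beta> t x + 1 / w2 * (1 - p2 N T \<nu> \<beta> t x)"
proof -
  have "x > 1"
    unfolding x using w assms by (intro gr_one_powr) auto
  then have "exponent t w1 w2 = 1 / w1 * prob {\<omega>\<in>space N. T \<omega> / \<beta> + 0 \<in> {s. gap s \<le> 0}}
           + 1 / w2 * (1 - prob {\<omega>\<in>space N. T \<omega> / \<beta> + t \<in> {s. gap s \<le> 0}})"
    by (intro exponent_split)
       (simp_all add: ratio_le_iff ratio_ge_iff zero_le_mult_iff mult_le_0_iff)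
  with \<open>x > 1\<close> show ?thesis
    by (simp add: p1_eq p2_eq)
qed

text \<open>Here \<open>x < 1\<close>, so the first density dominates off the interval, and both
  probabilities are replaced by their complements.\<close>

lemma exponent_above:
  assumes "w1 < w2"
  shows "exponent t w1 w2 = 1 / w1 * (1 - p1 N T \<nu> \<beta> t x) + 1 / w2 * p2 N T \<nu> \<beta> t x"
proof -
  have "x < 1"
    unfolding x using w assms powr_less_mono2[of "2 / (real \<nu> + 1)" "w1 / w2" 1] by simp
  then have "exponent t w1 w2 = 1 / w1 * prob {\<omega>\<in>space N. T \<omega> / \<beta> + 0 \<in> {s. gap s > 0}}
           + 1 / w2 * (1 - prob {\<omega>\<in>space N. T \<omega> / \<beta> + t \<in> {s. gap s > 0}})"
    by (intro exponent_split)
       (simp_all add: ratio_le_iff ratio_ge_iff zero_le_mult_iff mult_le_0_iff)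
  moreover have compl: "prob {\<omega>\<in>space N. T \<omega> / \<beta> + c \<in> {s. gap s > 0}}
               = 1 - prob {\<omega>\<in>space N. T \<omega> / \<beta> + c \<in> {s. gap s \<le> 0}}" for c
  proof -
    have "{\<omega>\<in>space N. gap (T \<omega> / \<beta> + c) \<le> 0} \<in> events"
      by measurable
    from prob_neg[OF this] show ?thesis
      by (simp add: not_le)
  qed
  ultimately show ?thesis
    using p1_eq[OF less_imp_neq] p2_eq[OF less_imp_neq] \<open>x < 1\<close> compl[of 0] by simp
qed

end

section \<open>Equal levels and degenerate intervals\<close>

text \<open>The density is even, and its law has no atom at \<open>c\<close>, so
  \<open>{c..}\<close> may be replaced by \<open>{c<..}\<close>.\<close>

lemma prob_T_minus: "prob {\<omega>\<in>space N. T \<omega> \<le> - c} = 1 - prob {\<omega>\<in>space N. T \<omega> \<le> c}"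
proof -
  have law: "prob {\<omega>\<in>space N. T \<omega> \<in> B} = (\<integral>s. t_density 1 \<nu> s * indicator B s \<partial>lborel)"
    if "B \<in> sets borel" for B
    using distributed_t_density[OF dist zero_less_one nu_pos that, of 0] by simp
  have "prob {\<omega>\<in>space N. T \<omega> \<le> - c} = (\<integral>s. t_density 1 \<nu> s * indicator {..- c} s \<partial>lborel)"
    using law[of "{..- c}"] by simp
  also have "\<dots> = (\<integral>s. t_density 1 \<nu> s * indicator {c..} s \<partial>lborel)"
    by (subst lborel_integral_real_affine[where c = "- 1" and t = 0])
       (auto simp: indicator_def intro!: Bochner_Integration.integral_cong)
  also have "\<dots> = (\<integral>s. t_density 1 \<nu> s * indicator {c<..} s \<partial>lborel)"
  proof (rule integral_cong_AE)
    have "AE s in lborel. s \<noteq> c"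
      by (rule AE_lborel_singleton)
    then show "AE s in lborel. t_density 1 \<nu> s * indicator {c..} s
                             = t_density 1 \<nu> s * indicator {c<..} s"
      by eventually_elim (auto simp: indicator_def)
  qed auto
  also have "\<dots> = prob {\<omega>\<in>space N. \<not> T \<omega> \<le> c}"
    using law[of "{c<..}"] by (simp add: not_le)
  also have "\<dots> = 1 - prob {\<omega>\<in>space N. T \<omega> \<le> c}"
    by (rule prob_neg) simp
  finally show ?thesis .
qed

lemma prob_T_eq: "prob {\<omega>\<in>space N. T \<omega> = c} = 0"
proof -
  have "prob {\<omega>\<in>space N. T \<omega> = c} = (\<integral>s. t_density 1 \<nu> s * indicator {c} s \<partial>lborel)"
    using distributed_t_density[OF dist zero_less_one nu_pos, of "{c}" 0] by simp
  also have "\<dots> = (\<integral>s. 0 \<partial>(lborel :: real measure))"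
    by (rule integral_cong_AE) (use AE_lborel_singleton[of c] in \<open>auto simp: indicator_def\<close>)
  finally show ?thesis by simp
qed

text \<open>Unimodality, read off from the comparison of densities with equal weights, where
  \<open>x = 1\<close>.\<close>

lemma t_density_mono_abs: "\<bar>u\<bar> \<le> \<bar>v\<bar> \<Longrightarrow> t_density \<beta> \<nu> v \<le> t_density \<beta> \<nu> u"
  using t_density_ratio_le_iff[OF beta_pos nu_pos zero_less_one zero_less_one, of v u]
    beta_pos nu_pos
  by (simp add: divide_right_mono mult_left_mono abs_le_square_iff)

text \<open>At equal levels the density whose centre, \<open>0\<close> or \<open>t\<close>, is
  nearer dominates, so the cut is at \<open>t / 2\<close>. By symmetry the two half lines contribute
  equally.\<close>

lemma exponent_diag:
  assumes "w > 0"
  shows "exponent t w w = 2 / w * prob {\<omega>\<in>space N. T \<omega> \<le> \<beta> * \<bar>t\<bar> / 2}"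
proof (cases "t \<ge> 0")
  case True
  have "exponent t w w = 1 / w * prob {\<omega>\<in>space N. T \<omega> / \<beta> + 0 \<in> {..t / 2}}
           + 1 / w * (1 - prob {\<omega>\<in>space N. T \<omega> / \<beta> + t \<in> {..t / 2}})"
    by (rule exponent_split)
       (use True assms in \<open>auto intro!: divide_right_mono t_density_mono_abs\<close>)
  also have "{\<omega>\<in>space N. T \<omega> / \<beta> + 0 \<in> {..t / 2}} = {\<omega>\<in>space N. T \<omega> \<le> \<beta> * \<bar>t\<bar> / 2}"
    using beta_pos True by (auto simp: field_simps)
  also have "{\<omega>\<in>space N. T \<omega> / \<beta> + t \<in> {..t / 2}} = {\<omega>\<in>space N. T \<omega> \<le> - (\<beta> * \<bar>t\<bar> / 2)}"
    using beta_pos True by (auto simp: field_simps)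
  finally show ?thesis
    by (simp add: prob_T_minus)
next
  case False
  \<comment> \<open>For negative \<open>t\<close> the points nearer to \<open>0\<close> lie to the
    right of \<open>t / 2\<close>.\<close>
  have "exponent t w w = 1 / w * prob {\<omega>\<in>space N. T \<omega> / \<beta> + 0 \<in> {t / 2<..}}
           + 1 / w * (1 - prob {\<omega>\<in>space N. T \<omega> / \<beta> + t \<in> {t / 2<..}})"
    by (rule exponent_split)
       (use False assms in \<open>auto intro!: divide_right_mono t_density_mono_abs\<close>)
  also have "{\<omega>\<in>space N. T \<omega> / \<beta> + 0 \<in> {t / 2<..}} = {\<omega>\<in>space N. \<not> T \<omega> \<le> - (\<beta> * \<bar>t\<bar> / 2)}"
    using beta_pos False by (auto simp: field_simps)
  also have "{\<omega>\<in>space N. T \<omega> / \<beta> + t \<in> {t / 2<..}} = {\<omega>\<in>space N. \<not> T \<omega> \<le> \<beta> * \<bar>t\<bar> / 2}"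
    using beta_pos False by (auto simp: field_simps)
  finally show ?thesis
    by (simp add: prob_neg prob_T_minus)
qed

text \<open>Outside the open interval between the roots the radicand is nonpositive, so each event
  is empty or forces \<open>T\<close> to equal a single value, which has probability
  \<open>0\<close>.\<close>

lemma p_eq_0:
  assumes "x \<le> b1 \<nu> \<beta> t \<or> b2 \<nu> \<beta> t \<le> x" "x \<noteq> 1"
  shows "p1 N T \<nu> \<beta> t x = 0" "p2 N T \<nu> \<beta> t x = 0"
proof -
  have "0 \<le> (x - b1 \<nu> \<beta> t) * (x - b2 \<nu> \<beta> t)"
    using assms(1) b1_le_b2[OF beta_pos] by (smt (verit) zero_le_mult_iff)
  also have "\<dots> = x * x - (b1 \<nu> \<beta> t + b2 \<nu> \<beta> t) * x + b1 \<nu> \<beta> t * b2 \<nu> \<beta> t"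
    by (simp add: algebra_simps)
  also have "\<dots> = (1 - x)\<^sup>2 - \<beta>\<^sup>2 * t\<^sup>2 / real \<nu> * x"
    unfolding b1_plus_b2 b1_mult_b2[OF nu_pos] by (simp add: algebra_simps power2_eq_square)
  finally have "\<beta>\<^sup>2 * (t\<^sup>2 * x) \<le> real \<nu> * (1 - x)\<^sup>2"
    using nu_pos by (simp add: pos_divide_le_eq mult.assoc mult.commute[of _ "real \<nu>"])
  then have "t\<^sup>2 * x / (1 - x)\<^sup>2 \<le> real \<nu> / \<beta>\<^sup>2"
    using beta_pos assms(2) by (simp add: pos_divide_le_eq pos_le_divide_eq mult.commute)
  then have "t\<^sup>2 * x / (1 - x)\<^sup>2 - real \<nu> / \<beta>\<^sup>2 \<le> 0"
    by simp
  \<comment> \<open>The root of a negative number is negative here, which makes the event empty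
    rather than undefined.\<close>
  then have *: "\<beta> * sqrt (t\<^sup>2 * x / (1 - x)\<^sup>2 - real \<nu> / \<beta>\<^sup>2) \<le> 0"
    using beta_pos by (simp add: mult_nonneg_nonpos)
  have **: "prob {\<omega>\<in>space N. \<bar>T \<omega> - c\<bar> \<le> r} = 0" if "r \<le> 0" for c r
  proof -
    have "prob {\<omega>\<in>space N. \<bar>T \<omega> - c\<bar> \<le> r} \<le> prob {\<omega>\<in>space N. T \<omega> = c}"
      using that by (intro finite_measure_mono) auto
    then show ?thesis
      using prob_T_eq[of c] by (simp add: measure_le_0_iff)
  qed
  show "p1 N T \<nu> \<beta> t x = 0" "p2 N T \<nu> \<beta> t x = 0"
    unfolding p1_def p2_def using **[OF *] by simp_all
qed

section \<open>The left limit at \<open>s = 1\<close>\<close>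

text \<open>The levels \<open>1 / s\<close> and \<open>1\<close> have \<open>w2 / w1 = s\<close>,
  and there \<open>1 / w1 + 1 / w2 = s + 1\<close>.\<close>

lemma exponent_chi_below:
  assumes "0 < s" "s < 1"
  shows "chi_below N T \<nu> \<beta> t s = exponent t (1 / s) 1 - 1 - s"
proof -
  have "s powr (- 2 / (real \<nu> + 1)) = ((1 / s) / 1) powr (2 / (real \<nu> + 1))"
    using assms by (simp add: powr_divide powr_minus inverse_eq_divide)
  from exponent_below[OF _ _ this] assms show ?thesis
    unfolding chi_below_def by simp
qed

text \<open>Lowering the weight of the first density from \<open>1\<close> to \<open>s\<close>
  lowers the integrand by at least \<open>0\<close> and at most \<open>1 - s\<close> times that
  density, which has mass \<open>1\<close>.\<close>

lemma exponent_bounds: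
  assumes "0 < s" "s < 1"
  shows "exponent t 1 1 - (1 - s) \<le> exponent t (1 / s) 1" "exponent t (1 / s) 1 \<le> exponent t 1 1"
proof -
  have int: "integrable lborel (\<lambda>u. max (t_density \<beta> \<nu> u * a) (t_density \<beta> \<nu> (u - t)))" for a
    using integrable_phi integrable_shift by auto
  have nonneg: "t_density \<beta> \<nu> u \<ge> 0" for u
    by (simp add: t_density_nonneg beta_pos nu_pos)
  have "exponent t 1 1 - (1 - s)
      = (\<integral>u. max (t_density \<beta> \<nu> u * 1) (t_density \<beta> \<nu> (u - t)) - (1 - s) * t_density \<beta> \<nu> u \<partial>lborel)"
    unfolding exponent_def
    by (subst Bochner_Integration.integral_diff)
       (use int[of 1] integrable_phi integral_phi in auto)
  also have "\<dots> \<le> (\<integral>u. max (t_density \<beta> \<nu> u * s) (t_density \<beta> \<nu> (u - t)) \<partial>lborel)"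
  proof (rule integral_mono[OF _ int])
    show "integrable lborel (\<lambda>u. max (t_density \<beta> \<nu> u * 1) (t_density \<beta> \<nu> (u - t))
                                 - (1 - s) * t_density \<beta> \<nu> u)"
      using int[of 1] integrable_phi by auto
    fix u
    have "(1 - s) * t_density \<beta> \<nu> u \<ge> 0"
      using nonneg assms by simp
    then show "max (t_density \<beta> \<nu> u * 1) (t_density \<beta> \<nu> (u - t)) - (1 - s) * t_density \<beta> \<nu> u
          \<le> max (t_density \<beta> \<nu> u * s) (t_density \<beta> \<nu> (u - t))"
      by (auto simp: max_def algebra_simps)
  qed
  finally show "exponent t 1 1 - (1 - s) \<le> exponent t (1 / s) 1"
    by (simp add: exponent_def)
  have "(\<integral>u. max (t_density \<beta> \<nu> u * s) (t_density \<beta> \<nu> (u - t)) \<partial>lborel)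
      \<le> (\<integral>u. max (t_density \<beta> \<nu> u * 1) (t_density \<beta> \<nu> (u - t)) \<partial>lborel)"
    using nonneg assms
    by (intro integral_mono int max.mono mult_left_mono) auto
  then show "exponent t (1 / s) 1 \<le> exponent t 1 1"
    by (simp add: exponent_def)
qed

text \<open>Squeezing between the bounds of \<open>exponent_bounds\<close> gives continuity from the
  left of the exponent; the correction \<open>- 1 - s\<close> tends to \<open>- 2\<close>.\<close>

lemma chi_below_tendsto: "(chi_below N T \<nu> \<beta> t \<longlongrightarrow> exponent t 1 1 - 2) (at_left 1)"
proof -
  have ev: "\<forall>\<^sub>F s in at_left (1::real). 0 < s \<and> s < 1"
    using eventually_at_left_real[of 0 "1::real"] by simp
  have "((\<lambda>s. exponent t (1 / s) 1) \<longlongrightarrow> exponent t 1 1) (at_left 1)"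
  proof (rule tendsto_sandwich)
    show "((\<lambda>s::real. exponent t 1 1 - (1 - s)) \<longlongrightarrow> exponent t 1 1) (at_left 1)"
      using tendsto_diff[OF tendsto_const tendsto_diff[OF tendsto_const tendsto_ident_at],
          of "exponent t 1 1" 1 1 "{..<1}"] by simp
    show "((\<lambda>s::real. exponent t 1 1) \<longlongrightarrow> exponent t 1 1) (at_left 1)"
      by simp
  qed (use ev in \<open>auto elim!: eventually_mono intro: exponent_bounds\<close>)
  then have "((\<lambda>s. exponent t (1 / s) 1 - 1 - s) \<longlongrightarrow> exponent t 1 1 - 1 - 1) (at_left 1)"
    by (intro tendsto_intros)
  then have "((\<lambda>s. exponent t (1 / s) 1 - 1 - s) \<longlongrightarrow> exponent t 1 1 - 2) (at_left 1)"
    by simp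
  then show ?thesis
    by (rule Lim_transform_eventually)
       (use ev in \<open>auto elim!: eventually_mono simp: exponent_chi_below\<close>)
qed

end

section \<open>Thresholds in terms of \<open>x\<close>, and assembly of the cases\<close>

text \<open>Raising to the positive power \<open>k\<close> preserves order. This translates the
  thresholds on \<open>w2\<close> into comparisons of \<open>x\<close> with \<open>b1\<close>,
  \<open>b2\<close> and \<open>1\<close>.\<close>

lemma powr_le_iff_ratio_ge:
  fixes b k w1 w2 :: real
  assumes "b > 0" "k > 0" "w1 > 0" "w2 > 0"
  shows "w2 \<le> b powr (- k) * w1 \<longleftrightarrow> b \<le> (w1 / w2) powr (1 / k)"
    and "b powr (- k) * w1 \<le> w2 \<longleftrightarrow> (w1 / w2) powr (1 / k) \<le> b"
proof -
  have eq: "((w1 / w2) powr (1 / k)) powr k = w1 / w2"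
    using assms by (simp add: powr_powr)
  have mono: "u powr k \<le> v powr k \<longleftrightarrow> u \<le> v" if "u > 0" "v > 0" for u v :: real
    using that \<open>k > 0\<close> by (meson less_eq_real_def not_le powr_less_mono2 powr_mono2)
  show "w2 \<le> b powr (- k) * w1 \<longleftrightarrow> b \<le> (w1 / w2) powr (1 / k)"
    using mono[of b "(w1 / w2) powr (1 / k)"] assms unfolding eq
    by (simp add: powr_minus field_simps)
  show "b powr (- k) * w1 \<le> w2 \<longleftrightarrow> (w1 / w2) powr (1 / k) \<le> b"
    using mono[of "(w1 / w2) powr (1 / k)" b] assms unfolding eq
    by (simp add: powr_minus field_simps)
qed

theorem proposition2p3:
  fixes M :: "'w measure" and N :: "'v measure"
    and X Y :: "nat \<Rightarrow> 'w \<Rightarrow> real" and Z :: "real \<Rightarrow> 'w \<Rightarrow> ereal"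
    and T :: "'v \<Rightarrow> real" and \<beta> t :: real and \<nu> :: nat
  assumes "\<beta> > 0" and "\<nu> > 0"
    and "prob_space M"
    and "poisson_process M lebesgue_half_plane (\<lambda>j \<omega>. (X j \<omega>, Y j \<omega>))"
    and "Z = moving_maximum (t_density \<beta> \<nu>) X Y"
    and "prob_space N"
    and "distributed N lborel T (\<lambda>y. ennreal (t_density 1 \<nu> y))"
  shows "(t \<noteq> 0 \<longrightarrow> (\<exists>l. (chi_below N T \<nu> \<beta> t \<longlongrightarrow> l) (at_left 1))) \<and>
    (\<forall>w1 > 0. \<forall>w2 > 0.
      (let x = (w1 / w2) powr (2 / (real \<nu> + 1));
           V = - ln (measure M {\<omega>\<in>space M. Z 0 \<omega> \<le> ereal w1 \<and> Z t \<omega> \<le> ereal w2});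
           c1 = b1 \<nu> \<beta> t powr (- ((real \<nu> + 1) / 2));
           c2 = b2 \<nu> \<beta> t powr (- ((real \<nu> + 1) / 2))
       in (w2 < c2 * w1 \<longrightarrow> V = 1 / w2) \<and>
          (c2 * w1 \<le> w2 \<and> w2 < w1 \<longrightarrow>
             V = 1 / w1 * p1 N T \<nu> \<beta> t x + 1 / w2 * (1 - p2 N T \<nu> \<beta> t x)) \<and>
          (w1 = w2 \<longrightarrow> V = 2 / w1 * measure N {\<omega>\<in>space N. T \<omega> \<le> \<beta> * \<bar>t\<bar> / 2}) \<and>
          (w1 < w2 \<and> w2 < c1 * w1 \<longrightarrow>
             V = 1 / w1 * (1 - p1 N T \<nu> \<beta> t x) + 1 / w2 * p2 N T \<nu> \<beta> t x) \<and>
          (c1 * w1 \<le> w2 \<longrightarrow> V = 1 / w1) \<and>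
          V = 1 / w1 + 1 / w2 + 1 / w2 * chi N T \<nu> \<beta> t (w2 / w1)))"
proof (intro conjI allI impI)
  interpret student_variable N T \<beta> \<nu>
    using assms by (intro student_variable.intro student_variable_axioms.intro)
  show "\<exists>l. (chi_below N T \<nu> \<beta> t \<longlongrightarrow> l) (at_left 1)"
    using chi_below_tendsto by blast
  fix w1 w2 :: real
  assume w: "w1 > 0" "w2 > 0"
  define x where "x = (w1 / w2) powr (2 / (real \<nu> + 1))"
  define V where "V = - ln (measure M {\<omega>\<in>space M. Z 0 \<omega> \<le> ereal w1 \<and> Z t \<omega> \<le> ereal w2})"
  define c1 where "c1 = b1 \<nu> \<beta> t powr (- ((real \<nu> + 1) / 2))"
  define c2 where "c2 = b2 \<nu> \<beta> t powr (- ((real \<nu> + 1) / 2))"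
  have V: "V = exponent t w1 w2"
    using moving_maximum_fdd2[OF assms(4) t_density_measurable integrable_phi
        t_density_nonneg[OF assms(1,2)] w, of 0 t]
    unfolding V_def exponent_def assms(5) by simp
  have bpos: "b1 \<nu> \<beta> t > 0" "b2 \<nu> \<beta> t > 0"
    using b1_pos[of \<beta> \<nu> t] b2_ge_1[of \<beta> \<nu> t] assms(1,2) by auto
  have k: "(real \<nu> + 1) / 2 > 0" "1 / ((real \<nu> + 1) / 2) = 2 / (real \<nu> + 1)"
    by auto
  have c2_iff: "w2 \<le> c2 * w1 \<longleftrightarrow> b2 \<nu> \<beta> t \<le> x"
    using powr_le_iff_ratio_ge(1)[OF bpos(2) k(1) w] unfolding x_def c2_def k(2) .
  have c1_iff: "c1 * w1 \<le> w2 \<longleftrightarrow> x \<le> b1 \<nu> \<beta> t"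
    using powr_le_iff_ratio_ge(2)[OF bpos(1) k(1) w] unfolding x_def c1_def k(2) .
  have x1: "x < 1 \<longleftrightarrow> w1 < w2" "1 < x \<longleftrightarrow> w2 < w1"
    using powr_le_iff_ratio_ge[OF zero_less_one k(1) w] unfolding x_def k(2) by auto
  \<comment> \<open>This formula and the next hold on the whole ranges \<open>w2 < w1\<close> and
    \<open>w1 < w2\<close>, so they cover every endpoint convention in the cases and in
    \<open>chi\<close>.\<close>
  have below: "V = 1 / w1 * p1 N T \<nu> \<beta> t x + 1 / w2 * (1 - p2 N T \<nu> \<beta> t x)" if "w2 < w1"
    using exponent_below[OF w x_def that] V by simp
  have above: "V = 1 / w1 * (1 - p1 N T \<nu> \<beta> t x) + 1 / w2 * p2 N T \<nu> \<beta> t x" if "w1 < w2"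
    using exponent_above[OF w x_def that] V by simp
  have diag: "V = 2 / w1 * prob {\<omega>\<in>space N. T \<omega> \<le> \<beta> * \<bar>t\<bar> / 2}" if "w1 = w2"
    using exponent_diag[OF w(1)] V that by simp
  \<comment> \<open>For \<open>t = 0\<close> both thresholds equal \<open>1\<close>, so the outer
    cases reach \<open>w1 = w2\<close>; there the two densities coincide.\<close>
  have t0: "V = 1 / w1" if "w1 = w2" "t = 0"
    using V integral_phi that by (simp add: exponent_def)
  \<comment> \<open>The weak inequality is what the first branch of \<open>chi\<close>
    requires.\<close>
  have low: "V = 1 / w2" if "w2 \<le> c2 * w1"
  proof -
    have "b2 \<nu> \<beta> t \<le> x"
      using that c2_iff by simp
    \<comment> \<open>Since \<open>b2\<close> is at least \<open>1\<close>, and larger than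
      \<open>1\<close> unless \<open>t = 0\<close>, the value \<open>x = 1\<close> leaves only
      \<open>t = 0\<close>.\<close>
    then consider "x > 1" | "x = 1" "t = 0"
      using b2_ge_1[of \<beta> \<nu> t] b2_gt_1[of \<beta> \<nu> t] assms(1,2) by fastforce
    then show ?thesis
    proof cases
      case 1
      then show ?thesis
        using below x1 p_eq_0[of x t] \<open>b2 \<nu> \<beta> t \<le> x\<close> by simp
    next
      case 2
      then show ?thesis
        using t0 x1 by (metis less_irrefl linorder_neqE_linordered_idom)
    qed
  qed
  have high: "V = 1 / w1" if "c1 * w1 \<le> w2"
  proof -
    have "x \<le> b1 \<nu> \<beta> t"
      using that c1_iff by simp
    then consider "x < 1" | "x = 1" "t = 0"
      using b1_le_1[of \<beta> \<nu> t] b1_less_1[of \<beta> \<nu> t] assms(1,2) by fastforce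
    then show ?thesis
    proof cases
      case 1
      then show ?thesis
        using above x1 p_eq_0[of x t] \<open>x \<le> b1 \<nu> \<beta> t\<close> by simp
    next
      case 2
      then show ?thesis
        using t0 x1 by (metis less_irrefl linorder_neqE_linordered_idom)
    qed
  qed
  have c_w: "w2 / w1 \<le> c \<longleftrightarrow> w2 \<le> c * w1" for c
    using w by (simp add: pos_divide_le_eq)
  have "(w2 / w1) powr (- 2 / (real \<nu> + 1)) = x"
    using w by (simp add: x_def powr_divide powr_minus field_simps)
  then have chi_eq: "1 / w2 * chi_below N T \<nu> \<beta> t (w2 / w1)
        = 1 / w1 * p1 N T \<nu> \<beta> t x - 1 / w1 - 1 / w2 * p2 N T \<nu> \<beta> t x"
      "1 / w2 * chi_above N T \<nu> \<beta> t (w2 / w1)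
        = - 1 / w1 * p1 N T \<nu> \<beta> t x - 1 / w2 + 1 / w2 * p2 N T \<nu> \<beta> t x"
    using w unfolding chi_below_def chi_above_def by (simp_all add: field_simps)
  consider (low) "w2 / w1 \<le> c2" | (below) "\<not> w2 / w1 \<le> c2" "w2 / w1 < 1"
    | (diag) "\<not> w2 / w1 \<le> c2" "w2 / w1 = 1"
    | (above) "\<not> w2 / w1 \<le> c2" "w2 / w1 > 1" "w2 / w1 \<le> c1"
    | (high) "\<not> w2 / w1 \<le> c2" "w2 / w1 > 1" "\<not> w2 / w1 \<le> c1"
    by linarith
  then have chi: "V = 1 / w1 + 1 / w2 + 1 / w2 * chi N T \<nu> \<beta> t (w2 / w1)"
  proof cases
    case low
    then have "chi N T \<nu> \<beta> t (w2 / w1) = - (w2 / w1)"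
      unfolding chi_def c2_def by simp
    then show ?thesis
      using \<open>w2 \<le> c2 * w1 \<Longrightarrow> V = 1 / w2\<close> low w by (simp add: c_w)
  next
    case below
    then have "chi N T \<nu> \<beta> t (w2 / w1) = chi_below N T \<nu> \<beta> t (w2 / w1)"
      unfolding chi_def c2_def by simp
    moreover have "w2 < w1"
      using below w by simp
    ultimately show ?thesis
      using \<open>w2 < w1 \<Longrightarrow> V = _\<close> chi_eq(1) by (simp add: right_diff_distrib diff_divide_distrib)
  next
    case diag
    then have "chi N T \<nu> \<beta> t (w2 / w1) = Lim (at_left 1) (chi_below N T \<nu> \<beta> t)"
      unfolding chi_def c2_def by simp
    also have "\<dots> = exponent t 1 1 - 2"
      by (rule tendsto_Lim[OF _ chi_below_tendsto]) simp
    finally have "chi N T \<nu> \<beta> t (w2 / w1) = exponent t 1 1 - 2" .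
    moreover have "w1 = w2"
      using diag w by simp
    \<comment> \<open>By \<open>exponent_diag\<close> the exponent at equal levels \<open>w1\<close>
      is \<open>exponent t 1 1 / w1\<close>, and the \<open>- 2\<close> cancels
      \<open>1 / w1 + 1 / w2\<close>.\<close>
    ultimately show ?thesis
      using V exponent_diag[OF w(1), of t] exponent_diag[OF zero_less_one, of t] w
      by (simp add: field_simps)
  next
    case above
    then have "chi N T \<nu> \<beta> t (w2 / w1) = chi_above N T \<nu> \<beta> t (w2 / w1)"
      unfolding chi_def c1_def c2_def by auto
    moreover have "w1 < w2"
      using above w by simp
    ultimately show ?thesis
      using \<open>w1 < w2 \<Longrightarrow> V = _\<close> chi_eq(2) by (simp add: right_diff_distrib diff_divide_distrib)
  next
    case high
    then have "chi N T \<nu> \<beta> t (w2 / w1) = - 1"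
      unfolding chi_def c1_def c2_def by auto
    then show ?thesis
      using \<open>c1 * w1 \<le> w2 \<Longrightarrow> V = 1 / w1\<close> high w by (simp add: c_w)
  qed
  show "let x = (w1 / w2) powr (2 / (real \<nu> + 1));
           V = - ln (measure M {\<omega>\<in>space M. Z 0 \<omega> \<le> ereal w1 \<and> Z t \<omega> \<le> ereal w2});
           c1 = b1 \<nu> \<beta> t powr (- ((real \<nu> + 1) / 2));
           c2 = b2 \<nu> \<beta> t powr (- ((real \<nu> + 1) / 2))
       in (w2 < c2 * w1 \<longrightarrow> V = 1 / w2) \<and>
          (c2 * w1 \<le> w2 \<and> w2 < w1 \<longrightarrow>
             V = 1 / w1 * p1 N T \<nu> \<beta> t x + 1 / w2 * (1 - p2 N T \<nu> \<beta> t x)) \<and>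
          (w1 = w2 \<longrightarrow> V = 2 / w1 * measure N {\<omega>\<in>space N. T \<omega> \<le> \<beta> * \<bar>t\<bar> / 2}) \<and>
          (w1 < w2 \<and> w2 < c1 * w1 \<longrightarrow>
             V = 1 / w1 * (1 - p1 N T \<nu> \<beta> t x) + 1 / w2 * p2 N T \<nu> \<beta> t x) \<and>
          (c1 * w1 \<le> w2 \<longrightarrow> V = 1 / w1) \<and>
          V = 1 / w1 + 1 / w2 + 1 / w2 * chi N T \<nu> \<beta> t (w2 / w1)"
    using low below diag above high chi
    unfolding Let_def x_def[symmetric] V_def[symmetric] c1_def[symmetric] c2_def[symmetric]
    by auto
qed

end
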